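(* Let $\Delta t>0$ and let $x^m_h \in \underline{V}^h$ be such that $|x^m_{h,\rho}| > 0$ in $I$ (i.e. the constant vector $x^m_{h,\rho}|_{I_j}$ is nonzero for every $j=1,\ldots,J$). Then there exists a unique $x^{m+\frac12}_h \in \underline{V}^h$ such that $$\left(\frac{x^{m+\frac12}_h-x^m_h}{\frac12\Delta t} , \eta_h |x^m_{h,\rho}|^2 \right)^h + \left( x^{m+\frac12}_{h,\rho} , \eta_{h,\rho} \right) = 0 \qquad \forall\ \eta_h \in \underline{V}^h, \qquad (P)$$ and, with this $x^{m+\frac12}_h$, there exists a unique $x^{m+1}_h \in \underline{V}^h$ such that $$\left( \frac{x^{m+1}_h-x^m_h}{\Delta t} , \eta_h |x^{m+\frac12}_{h,\rho}|^2 \right)^h + \tfrac12 \left(x^{m+1}_{h,\rho} + x^{m}_{h,\rho} , \eta_{h,\rho} \right) = 0 \qquad \forall\ \eta_h \in \underline{V}^h. \qquad (C)$$ Moreover, any solution $x^{m+1}_h$ to (C) satisfies the stability estimate $$\tfrac12 |x^{m+1}_{h}|^2_1 + \frac1{\Delta t} \left( | x^{m+1}_{h} - x^m_h|^2, |x^{m+\frac12}_{h,\rho} |^2 \right)^h = \tfrac12 |x^m_{h}|^2_1 .$$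
   Context: Let $d\ge 2$ and let $I=\mathbb{R}/\mathbb{Z}$ be the periodic unit interval. Let $[0,1]=\bigcup_{j=1}^J I_j$, $J\ge 3$, be a decomposition into intervals $I_j=[\rho_{j-1},\rho_j]$, where $0=\rho_0<\rho_1<\dots<\rho_J=1$, with $\rho_0$ and $\rho_J$ identified by periodicity. Let $h_j=\rho_j-\rho_{j-1}$ and $h=\max_{1\le j\le J}h_j$. (Throughout it is assumed that $|h_j-h_{j-1}|\le c h^2$ and $h\le c h_j$ for $j=1,\ldots,J$, with indices understood periodically and $c$ a constant independent of $h$.) Finite element spaces: $V^h=\{\chi\in C^0(I): \chi|_{I_j}\text{ is affine},\ j=1,\ldots,J\}$ and $\underline{V}^h=[V^h]^d$ (continuous, periodic, piecewise affine functions with values in $\mathbb{R}^d$). A subscript $\rho$ denotes differentiation with respect to the parameter $\rho\in I$; thus $x_{h,\rho}$ is piecewise constant for $x_h\in\underline{V}^h$. $(\cdot,\cdot)$ denotes the $L^2$-inner product on $I$ and $|u|_1=\left(\int_I|u_\rho|^2\,d\rho\right)^{1/2}$ is the $H^1(I)$-seminorm. For piecewise continuous (scalar or vector valued) functions $u,v$ with possible jumps at the nodes, the mass lumped inner product is $$(u,v)^h=\tfrac12\sum_{j=1}^J h_j\left[(u\cdot v)(\rho_j^-)+(u\cdot v)(\rho_{j-1}^+)\right],\qquad (u\cdot v)(\rho_j^\pm)=\lim_{\delta\searrow0}(u\cdot v)(\rho_j\pm\delta).$$ $|\cdot|$ denotes the Euclidean norm in $\mathbb{R}^d$. *)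

theory Defs
  imports "HOL-Analysis.Analysis"
begin

text \<open>Functions on the periodic unit interval \<open>I = \<real>/\<int>\<close> are represented by 1-periodic functions on
  \<open>\<real>\<close>, so that equality of functions on \<open>I\<close> is equality in HOL and continuity on \<open>I\<close> is continuity
  on \<open>\<real>\<close>. A decomposition of \<open>[0,1]\<close> is given by its number \<open>J\<close> of intervals and its nodes
  \<open>\<rho> 0, \<dots>, \<rho> J\<close>; values of \<open>\<rho>\<close> beyond \<open>J\<close> are irrelevant.\<close>

definition mesh :: "nat \<Rightarrow> (nat \<Rightarrow> real) \<Rightarrow> bool" where
  "mesh J \<rho> \<longleftrightarrow> \<rho> 0 = 0 \<and> \<rho> J = 1 \<and> strict_mono_on {0..J} \<rho>"

definition mesh_int :: "(nat \<Rightarrow> real) \<Rightarrow> nat \<Rightarrow> real set" where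
  "mesh_int \<rho> j = {\<rho> (j - 1)..\<rho> j}"

text \<open>Indices are periodic: \<open>h\<^sub>0 = h\<^sub>J\<close>.\<close>

definition mesh_len :: "nat \<Rightarrow> (nat \<Rightarrow> real) \<Rightarrow> nat \<Rightarrow> real" where
  "mesh_len J \<rho> j = (if j = 0 then \<rho> J - \<rho> (J - 1) else \<rho> j - \<rho> (j - 1))"

definition mesh_size :: "nat \<Rightarrow> (nat \<Rightarrow> real) \<Rightarrow> real" where
  "mesh_size J \<rho> = Max (mesh_len J \<rho> ` {1..J})"

definition mesh_regular :: "real \<Rightarrow> nat \<Rightarrow> (nat \<Rightarrow> real) \<Rightarrow> bool" where
  "mesh_regular c J \<rho> \<longleftrightarrow>
     (\<forall>j\<in>{1..J}. \<bar>mesh_len J \<rho> j - mesh_len J \<rho> (j - 1)\<bar> \<le> c * (mesh_size J \<rho>)\<^sup>2 \<and>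
                 mesh_size J \<rho> \<le> c * mesh_len J \<rho> j)"

definition Vh :: "nat \<Rightarrow> (nat \<Rightarrow> real) \<Rightarrow> (real \<Rightarrow> real) set" where
  "Vh J \<rho> = {v. (\<forall>t. v (t + 1) = v t) \<and> continuous_on UNIV v \<and>
                (\<forall>j\<in>{1..J}. \<exists>a b. \<forall>t\<in>mesh_int \<rho> j. v t = a + b * t)}"

definition Vh_vec :: "nat \<Rightarrow> (nat \<Rightarrow> real) \<Rightarrow> (real \<Rightarrow> real ^ 'd) set" where
  "Vh_vec J \<rho> = {x. \<forall>i. (\<lambda>t. x t $ i) \<in> Vh J \<rho>}"

text \<open>The derivative with respect to the parameter. For a piecewise affine function its value at a
  node is arbitrary where the one-sided slopes differ; neither the integrals nor the one-sided
  limits below depend on the values at the nodes.\<close>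

abbreviation d_rho :: "(real \<Rightarrow> 'b::real_normed_vector) \<Rightarrow> real \<Rightarrow> 'b" where
  "d_rho u \<equiv> \<lambda>t. vector_derivative u (at t)"

definition L2_inner :: "(real \<Rightarrow> 'b::real_inner) \<Rightarrow> (real \<Rightarrow> 'b) \<Rightarrow> real" where
  "L2_inner u v = integral {0..1} (\<lambda>t. u t \<bullet> v t)"

definition H1_seminorm :: "(real \<Rightarrow> 'b::real_normed_vector) \<Rightarrow> real" where
  "H1_seminorm u = sqrt (integral {0..1} (\<lambda>t. (norm (d_rho u t))\<^sup>2))"

text \<open>The mass lumped inner product; for real-valued functions \<open>\<bullet>\<close> is multiplication.\<close>

definition lumped :: "nat \<Rightarrow> (nat \<Rightarrow> real) \<Rightarrow> (real \<Rightarrow> 'b::real_inner) \<Rightarrow> (real \<Rightarrow> 'b) \<Rightarrow> real" where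
  "lumped J \<rho> u v = 1 / 2 * (\<Sum>j = 1..J. mesh_len J \<rho> j *
     (Lim (at_left (\<rho> j)) (\<lambda>t. u t \<bullet> v t) + Lim (at_right (\<rho> (j - 1))) (\<lambda>t. u t \<bullet> v t)))"

definition predictor_sol ::
  "nat \<Rightarrow> (nat \<Rightarrow> real) \<Rightarrow> real \<Rightarrow> (real \<Rightarrow> real ^ 'd) \<Rightarrow> (real \<Rightarrow> real ^ 'd) \<Rightarrow> bool" where
  "predictor_sol J \<rho> \<tau> xm xh \<longleftrightarrow> xh \<in> Vh_vec J \<rho> \<and>
     (\<forall>\<eta>\<in>Vh_vec J \<rho>.
        lumped J \<rho> (\<lambda>t. (xh t - xm t) /\<^sub>R (1 / 2 * \<tau>)) (\<lambda>t. (norm (d_rho xm t))\<^sup>2 *\<^sub>R \<eta> t)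
        + L2_inner (d_rho xh) (d_rho \<eta>) = 0)"

definition corrector_sol ::
  "nat \<Rightarrow> (nat \<Rightarrow> real) \<Rightarrow> real \<Rightarrow> (real \<Rightarrow> real ^ 'd) \<Rightarrow> (real \<Rightarrow> real ^ 'd) \<Rightarrow> (real \<Rightarrow> real ^ 'd) \<Rightarrow> bool"
  where
  "corrector_sol J \<rho> \<tau> xm xh x \<longleftrightarrow> x \<in> Vh_vec J \<rho> \<and>
     (\<forall>\<eta>\<in>Vh_vec J \<rho>.
        lumped J \<rho> (\<lambda>t. (x t - xm t) /\<^sub>R \<tau>) (\<lambda>t. (norm (d_rho xh t))\<^sup>2 *\<^sub>R \<eta> t)
        + 1 / 2 * L2_inner (\<lambda>t. d_rho x t + d_rho xm t) (d_rho \<eta>) = 0)"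

end

theory Submission imports Defs "Jordan_Normal_Form.Determinant" begin

text \<open>
  Both steps of the scheme are one linear problem. Let \<open>z\<close> be the increment \<open>x - x\<^sup>m\<close>. Predictor and
  corrector then ask for a finite element function \<open>z\<close> such that, for all test functions \<open>\<eta>\<close>,
    \<open>\<alpha> (z, w \<eta>)\<^sup>h + \<kappa> (z\<^sub>\<rho>, \<eta>\<^sub>\<rho>) + (x\<^sup>m\<^sub>\<rho>, \<eta>\<^sub>\<rho>) = 0,\<close>
  with \<open>(\<alpha>, \<kappa>) = (2 / \<tau>, 1)\<close> and \<open>w = |x\<^sup>m\<^sub>\<rho>|\<^sup>2\<close> for the predictor, and
  \<open>(\<alpha>, \<kappa>) = (1 / \<tau>, 1 / 2)\<close> and \<open>w\<close> the squared length of the predictor's derivative for the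
  corrector, where \<open>x + x\<^sup>m = z + 2 x\<^sup>m\<close> accounts for the common last term. The
  weight is constant and nonnegative on each mesh interval.

  The form \<open>\<alpha> (z, w z)\<^sup>h + \<kappa> |z|\<^sub>1\<^sup>2\<close> is definite as soon as the weight is positive on a single
  interval (\<open>nodal_definite\<close>): if the form vanishes, then \<open>z\<close> is constant because of the
  stiffness term, and the mass term on that interval makes the constant zero. Definiteness gives
  uniqueness, and since the problem is a square linear system in the nodal values it
  gives existence as well (\<open>step_uniquely_solvable\<close>). The weight being
  scalar, the system splits into one system for each coordinate.

  For the predictor the weight is positive everywhere by hypothesis. For the corrector it could
  vanish on some intervals, but not on all: a constant predictor would satisfy
  \<open>(z, w \<eta>)\<^sup>h = 0\<close> for all \<open>\<eta>\<close> with a positive weight, so it would coincide with \<open>x\<^sup>m\<close> at the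
  nodes, and \<open>x\<^sup>m\<close> would be constant (\<open>predictor_not_constant\<close>).

  The stability identity is the corrector tested with \<open>\<eta> = x - x\<^sup>m\<close>, because
  \<open>(x\<^sub>\<rho> + x\<^sup>m\<^sub>\<rho>) \<cdot> (x\<^sub>\<rho> - x\<^sup>m\<^sub>\<rho>) = |x\<^sub>\<rho>|\<^sup>2 - |x\<^sup>m\<^sub>\<rho>|\<^sup>2\<close> (\<open>corrector_energy\<close>).

  The number of nodes is a variable rather than a type. The linear system is therefore solved with matrices
  whose dimension is a natural number, while the finite element functions themselves stay ordinary
  functions on the real line, described through their values at the nodes.
\<close>

text \<open>The two symbols are reserved for the inner product and the components of \<open>\<real>\<^sup>d\<close>.\<close>

no_notation scalar_prod (infix \<open>\<bullet>\<close> 70)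
no_notation vec_index (infixl \<open>$\<close> 100)

section \<open>Definite Galerkin systems\<close>

text \<open>With a trivial kernel the determinant is
  nonzero, so the matrix has an inverse, which is applied to the right-hand side.\<close>

lemma square_system_solvable:
  fixes A :: "nat \<Rightarrow> nat \<Rightarrow> 'k::field"
  assumes inj: "\<And>c. (\<And>i. i < n \<Longrightarrow> (\<Sum>k<n. A i k * c k) = 0) \<Longrightarrow> (\<forall>k<n. c k = 0)"
  shows "\<exists>c. \<forall>i<n. (\<Sum>k<n. A i k * c k) = b i"
proof -
  define M where "M = mat n n (\<lambda>(i, k). A i k)"
  have M: "M \<in> carrier_mat n n"
    by (simp add: M_def)
  have entry: "vec_index (M *\<^sub>v v) i = (\<Sum>k<n. A i k * vec_index v k)"
    if "v \<in> carrier_vec n" "i < n" for v i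
    using that by (simp add: M_def scalar_prod_def lessThan_atLeast0)
  have "v = 0\<^sub>v n" if v: "v \<in> carrier_vec n" and Mv: "M *\<^sub>v v = 0\<^sub>v n" for v
  proof -
    have "(\<Sum>k<n. A i k * vec_index v k) = 0" if "i < n" for i
      using entry[OF v that] that by (simp add: Mv)
    then have "\<forall>k<n. vec_index v k = 0"
      by (rule inj)
    then show ?thesis
      using v by (intro eq_vecI) auto
  qed
  then have "det M \<noteq> 0"
    using det_0_iff_vec_prod_zero_field[OF M] by auto
  then have "M \<in> Units (ring_mat TYPE('k) n ())"
    by (rule det_non_zero_imp_unit[OF M])
  then obtain B where B: "B \<in> carrier_mat n n" and MB: "M * B = 1\<^sub>m n"
    unfolding Units_def ring_mat_def by auto
  define v where "v = B *\<^sub>v vec n b"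
  have v: "v \<in> carrier_vec n"
    using B by (simp add: v_def)
  have "M *\<^sub>v v = vec n b"
    unfolding v_def using M B MB
    by (subst assoc_mult_mat_vec[symmetric, of _ n n _ n]) auto
  then have "(\<Sum>k<n. A i k * vec_index v k) = b i" if "i < n" for i
    using entry[OF v that] that by simp
  then show ?thesis
    by (intro exI[of _ "vec_index v"]) blast
qed

text \<open>By linearity it suffices to test with each \<open>\<phi> i\<close>, which leaves a square linear system for the
  coefficients. A coefficient vector in its kernel gives a combination \<open>u\<close> with \<open>a u u = 0\<close>, so
  definiteness makes the kernel trivial. Linearity is phrased through pointwise combinations
  since the arguments are plain functions.\<close>

lemma galerkin_solvable:
  fixes a :: "('x \<Rightarrow> real) \<Rightarrow> ('x \<Rightarrow> real) \<Rightarrow> real" and \<phi> :: "nat \<Rightarrow> 'x \<Rightarrow> real"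
  assumes lin1: "\<And>u v r e. a (\<lambda>t. u t + r * v t) e = a u e + r * a v e"
    and lin2: "\<And>u v r e. a e (\<lambda>t. u t + r * v t) = a e u + r * a e v"
    and linL: "\<And>u v r. L (\<lambda>t. u t + r * v t) = L u + r * L v"
    and definite: "\<And>c. a (\<lambda>t. \<Sum>k<n. c k * \<phi> k t) (\<lambda>t. \<Sum>k<n. c k * \<phi> k t) = 0 \<Longrightarrow> \<forall>k<n. c k = 0"
  shows "\<exists>c. \<forall>d. a (\<lambda>t. \<Sum>k<n. c k * \<phi> k t) (\<lambda>t. \<Sum>k<n. d k * \<phi> k t) = L (\<lambda>t. \<Sum>k<n. d k * \<phi> k t)"
proof -
  have sum_lin: "F (\<lambda>t. \<Sum>k<m. c k * \<phi> k t) = (\<Sum>k<m. c k * F (\<phi> k))"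
    if F: "\<And>u v r. F (\<lambda>t. u t + r * v t) = F u + r * F v" for F :: "('x \<Rightarrow> real) \<Rightarrow> real" and c m
  proof (induction m)
    case 0
    \<comment> \<open>The coefficient \<open>-1\<close> turns linearity into \<open>F 0 = F 0 - F 0\<close>.\<close>
    have "F (\<lambda>t. 0) = 0"
      using F[of "\<lambda>t. 0" "-1" "\<lambda>t. 0"] by simp
    then show ?case by simp
  next
    case (Suc m)
    then show ?case
      using F[of "\<lambda>t. \<Sum>k<m. c k * \<phi> k t" "c m" "\<phi> m"] by simp
  qed
  let ?S = "\<lambda>c t. \<Sum>k<n. c k * \<phi> k t"
  have a1: "a (?S c) e = (\<Sum>k<n. a (\<phi> k) e * c k)" for c e
    using sum_lin[where F = "\<lambda>u. a u e" and m = n and c = c] lin1 by (simp add: mult.commute)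
  have a2: "a e (?S d) = (\<Sum>i<n. d i * a e (\<phi> i))" for d e
    using sum_lin[where F = "a e" and m = n and c = d] lin2 by simp
  have "\<forall>k<n. c k = 0" if c: "\<And>i. i < n \<Longrightarrow> (\<Sum>k<n. a (\<phi> k) (\<phi> i) * c k) = 0" for c
  proof (rule definite)
    show "a (?S c) (?S c) = 0"
      unfolding a2 by (rule sum.neutral) (use c in \<open>simp add: a1\<close>)
  qed
  then have "\<exists>c. \<forall>i<n. (\<Sum>k<n. a (\<phi> k) (\<phi> i) * c k) = L (\<phi> i)"
    by (rule square_system_solvable)
  then obtain c where c: "\<forall>i<n. (\<Sum>k<n. a (\<phi> k) (\<phi> i) * c k) = L (\<phi> i)" ..
  have "a (?S c) (?S d) = L (?S d)" for d
    unfolding a2 using sum_lin[where F = L and m = n and c = d] linL c by (simp add: a1)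
  then show ?thesis by blast
qed

section \<open>Nodal values of finite element functions\<close>

lemma mesh_less: "mesh J \<rho> \<Longrightarrow> i < j \<Longrightarrow> j \<le> J \<Longrightarrow> \<rho> i < \<rho> j"
  by (auto simp: mesh_def strict_mono_on_def)

lemma mesh_le: "mesh J \<rho> \<Longrightarrow> i \<le> j \<Longrightarrow> j \<le> J \<Longrightarrow> \<rho> i \<le> \<rho> j"
  using mesh_less[of J \<rho> i j] by (cases "i = j") auto

lemma mesh_len_pos: "mesh J \<rho> \<Longrightarrow> j \<in> {1..J} \<Longrightarrow> 0 < mesh_len J \<rho> j"
  using mesh_less[of J \<rho> "j - 1" j] by (auto simp: mesh_len_def)

lemma mesh_len_eq: "j \<in> {1..J} \<Longrightarrow> mesh_len J \<rho> j = \<rho> j - \<rho> (j - 1)"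
  by (auto simp: mesh_len_def)

text \<open>A positive point lies in the interval that ends at the first node not to its left.\<close>

lemma mesh_cover:
  assumes m: "mesh J \<rho>" and t: "t \<in> {0..1}"
  shows "\<exists>j\<in>{1..J}. t \<in> mesh_int \<rho> j"
proof -
  define j where "j = (LEAST k. t \<le> \<rho> k)"
  have J: "t \<le> \<rho> J" and r0: "\<rho> 0 = 0" "\<rho> J = 1"
    using m t by (auto simp: mesh_def)
  have j: "t \<le> \<rho> j" "j \<le> J"
    unfolding j_def using J by (auto intro: LeastI Least_le)
  show ?thesis
  proof (cases "j = 0")
    case True
    then have "t = 0"
      using j t r0 by auto
    moreover have "J > 0"
      using r0 by (cases "J = 0") auto
    ultimately show ?thesis
      using mesh_less[OF m, of 0 1] r0 by (intro bexI[of _ 1]) (auto simp: mesh_int_def)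
  next
    case False
    then have "\<not> t \<le> \<rho> (j - 1)"
      unfolding j_def by (intro not_less_Least) auto
    then show ?thesis
      using False j by (intro bexI[of _ j]) (auto simp: mesh_int_def)
  qed
qed

lemma Vh_add_scaled:
  assumes "u \<in> Vh J \<rho>" "v \<in> Vh J \<rho>"
  shows "(\<lambda>t. u t + r * v t) \<in> Vh J \<rho>"
proof -
  have "\<exists>a b. \<forall>t\<in>mesh_int \<rho> j. u t + r * v t = a + b * t" if j: "j \<in> {1..J}" for j
  proof -
    obtain a b where ab: "\<forall>t\<in>mesh_int \<rho> j. u t = a + b * t"
      using assms(1) j unfolding Vh_def by blast
    obtain a' b' where ab': "\<forall>t\<in>mesh_int \<rho> j. v t = a' + b' * t"
      using assms(2) j unfolding Vh_def by blast
    have "\<forall>t\<in>mesh_int \<rho> j. u t + r * v t = (a + r * a') + (b + r * b') * t"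
      using ab ab' by (simp add: algebra_simps)
    then show ?thesis by blast
  qed
  moreover have "continuous_on UNIV (\<lambda>t. u t + r * v t)"
    using assms by (intro continuous_intros) (auto simp: Vh_def)
  moreover have "u (t + 1) + r * v (t + 1) = u t + r * v t" for t
    using assms by (auto simp: Vh_def)
  ultimately show ?thesis
    by (auto simp: Vh_def)
qed

lemma zero_in_Vh: "(\<lambda>t. 0) \<in> Vh J \<rho>"
  unfolding Vh_def by (auto intro!: exI[of _ 0])

lemma sum_in_Vh:
  fixes n :: nat
  assumes "\<And>k. k < n \<Longrightarrow> \<phi> k \<in> Vh J \<rho>"
  shows "(\<lambda>t. \<Sum>k<n. c k * \<phi> k t) \<in> Vh J \<rho>"
  using assms
proof (induction n)
  case 0
  then show ?case by (simp add: zero_in_Vh)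
next
  case (Suc n)
  then show ?case
    using Vh_add_scaled[of "\<lambda>t. \<Sum>k<n. c k * \<phi> k t" J \<rho> "\<phi> n" "c n"] by simp
qed

lemma Vh_vec_add:
  assumes "u \<in> Vh_vec J \<rho>" "v \<in> Vh_vec J \<rho>"
  shows "(\<lambda>t. u t + v t) \<in> Vh_vec J \<rho>"
  using assms Vh_add_scaled[of _ J \<rho> _ 1] by (auto simp: Vh_vec_def)

lemma Vh_vec_diff:
  assumes "u \<in> Vh_vec J \<rho>" "v \<in> Vh_vec J \<rho>"
  shows "(\<lambda>t. u t - v t) \<in> Vh_vec J \<rho>"
  using assms Vh_add_scaled[of _ J \<rho> _ "-1"] by (auto simp: Vh_vec_def)

lemma Vh_affine:
  assumes m: "mesh J \<rho>" and u: "u \<in> Vh J \<rho>" and j: "j \<in> {1..J}" and t: "t \<in> mesh_int \<rho> j"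
  shows "u t = u (\<rho> (j - 1)) + (t - \<rho> (j - 1)) / mesh_len J \<rho> j * (u (\<rho> j) - u (\<rho> (j - 1)))"
proof -
  obtain a b where ab: "\<forall>t\<in>mesh_int \<rho> j. u t = a + b * t"
    using u j unfolding Vh_def by blast
  have "\<rho> (j - 1) < \<rho> j"
    using mesh_len_pos[OF m j] mesh_len_eq[OF j] by simp
  then show ?thesis
    using ab t by (simp add: mesh_int_def mesh_len_eq[OF j] field_simps)
qed

lemma Vh_vec_affine:
  assumes "mesh J \<rho>" "u \<in> Vh_vec J \<rho>" "j \<in> {1..J}" "t \<in> mesh_int \<rho> j"
  shows "u t = u (\<rho> (j - 1)) +
    ((t - \<rho> (j - 1)) / mesh_len J \<rho> j) *\<^sub>R (u (\<rho> j) - u (\<rho> (j - 1)))"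
  using assms Vh_affine[of J \<rho> "\<lambda>t. u t $ i" j t for i]
  by (auto simp: Finite_Cartesian_Product.vec_eq_iff Vh_vec_def)

text \<open>The nodes with \<open>k < J\<close> suffice since periodicity gives the value at the last node. Between
  nodes an affine function is determined by its end values, and every real point is
  congruent modulo 1 to one in the unit interval.\<close>

lemma Vh_eqI:
  assumes m: "mesh J \<rho>" and u: "u \<in> Vh J \<rho>" and v: "v \<in> Vh J \<rho>"
    and nodes: "\<And>k. k < J \<Longrightarrow> u (\<rho> k) = v (\<rho> k)"
  shows "u = v"
proof
  fix t :: real
  have per: "u (x + of_int n) = u x" "v (x + of_int n) = v x" for x :: real and n
  proof -
    have *: "w (x + of_int n) = w x" if "\<And>t. w (t + 1) = w t" for w :: "real \<Rightarrow> real"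
    proof (induction n rule: int_induct[where ?k = 0])
      case base
      then show ?case by simp
    next
      case (step1 i)
      then show ?case using that[of "x + of_int i"] by (simp add: ac_simps)
    next
      case (step2 i)
      then show ?case using that[of "x + of_int (i - 1)"] by (simp add: algebra_simps)
    qed
    show "u (x + of_int n) = u x" "v (x + of_int n) = v x"
      using u v by (auto simp: Vh_def intro!: *)
  qed
  have "u (\<rho> J) = v (\<rho> J)"
  proof (cases "J = 0")
    case False
    then show ?thesis
      using nodes[of 0] per[of 0 1] m by (simp add: mesh_def)
  qed (use m in \<open>simp add: mesh_def\<close>)
  then have all: "u (\<rho> k) = v (\<rho> k)" if "k \<le> J" for k
    using nodes that by (cases "k = J") auto
  have "frac t \<in> {0..1}"
    using frac_lt_1[of t] by (auto intro: less_imp_le)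
  then obtain j where j: "j \<in> {1..J}" "frac t \<in> mesh_int \<rho> j"
    using mesh_cover[OF m] by blast
  have "u (\<rho> j) = v (\<rho> j)" "u (\<rho> (j - 1)) = v (\<rho> (j - 1))"
    using j by (auto intro: all)
  then have "u (frac t) = v (frac t)"
    using Vh_affine[OF m u j] Vh_affine[OF m v j] by simp
  then show "u t = v t"
    using per[of "frac t" "\<lfloor>t\<rfloor>"] by (simp add: frac_def)
qed

lemma Vh_vec_eqI:
  assumes "mesh J \<rho>" "u \<in> Vh_vec J \<rho>" "v \<in> Vh_vec J \<rho>" "\<And>k. k < J \<Longrightarrow> u (\<rho> k) = v (\<rho> k)"
  shows "u = v"
proof -
  have "(\<lambda>t. u t $ i) = (\<lambda>t. v t $ i)" for i
    using assms by (intro Vh_eqI[of J \<rho>]) (auto simp: Vh_vec_def)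
  then show ?thesis
    by (auto simp: Finite_Cartesian_Product.vec_eq_iff fun_eq_iff)
qed

text \<open>The interpolant is built from left to right. To pass the node \<open>\<rho> n\<close>, freeze the function
  found so far at its value there and add a ramp that starts at \<open>\<rho> n\<close>; this keeps continuity
  and does not disturb the intervals already treated.\<close>

lemma piecewise_affine_interpolation:
  assumes m: "mesh J \<rho>" and n: "n \<le> J"
  shows "\<exists>g. continuous_on UNIV g \<and> (\<forall>k\<le>n. g (\<rho> k) = b k) \<and>
    (\<forall>j\<in>{1..n}. \<exists>p q. \<forall>t\<in>mesh_int \<rho> j. g t = p + q * t)"
  using n
proof (induction n)
  case 0
  show ?case by (intro exI[of _ "\<lambda>t. b 0"]) auto
next
  case (Suc n)
  then obtain g where g: "continuous_on UNIV g" "\<And>k. k \<le> n \<Longrightarrow> g (\<rho> k) = b k"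
    and aff: "\<And>j. j \<in> {1..n} \<Longrightarrow> \<exists>p q. \<forall>t\<in>mesh_int \<rho> j. g t = p + q * t"
    by auto
  have less: "\<rho> n < \<rho> (Suc n)"
    using mesh_less[OF m, of n "Suc n"] Suc.prems by simp
  have le: "\<rho> k \<le> \<rho> n" if "k \<le> n" for k
    using mesh_le[OF m, of k n] that Suc.prems by simp
  \<comment> \<open>The slope that reaches the prescribed value at the next node.\<close>
  define s where "s = (b (Suc n) - b n) / (\<rho> (Suc n) - \<rho> n)"
  define f where "f t = g (min t (\<rho> n)) + s * max 0 (t - \<rho> n)" for t
  have "continuous_on UNIV f"
    unfolding f_def by (intro continuous_intros continuous_on_compose2[OF g(1)]) auto
  moreover have "f (\<rho> k) = b k" if "k \<le> Suc n" for k
  proof (cases "k = Suc n")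
    case True
    then show ?thesis using less g(2)[of n] by (simp add: f_def s_def)
  next
    case False
    then show ?thesis using that le[of k] g(2)[of k] by (simp add: f_def)
  qed
  moreover have "\<exists>p q. \<forall>t\<in>mesh_int \<rho> j. f t = p + q * t" if j: "j \<in> {1..Suc n}" for j
  proof (cases "j = Suc n")
    case True
    have "\<forall>t\<in>mesh_int \<rho> j. f t = (g (\<rho> n) - s * \<rho> n) + s * t"
      using True by (auto simp: mesh_int_def f_def algebra_simps)
    then show ?thesis by blast
  next
    case False
    then have jn: "j \<in> {1..n}" using j by auto
    obtain p q where "\<forall>t\<in>mesh_int \<rho> j. g t = p + q * t"
      using aff[OF jn] by blast
    then have "\<forall>t\<in>mesh_int \<rho> j. f t = p + q * t"
      using le[of j] jn by (auto simp: mesh_int_def f_def)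
    then show ?thesis by blast
  qed
  ultimately show ?case by blast
qed

text \<open>Gluing at the integers is the only difficulty, since \<open>frac\<close> jumps there. Let \<open>G\<close> be \<open>g\<close> frozen
  outside the unit interval. Near a point of integer part \<open>n\<close> the extension equals
  \<open>G (t - n) + G (t - n + 1) - g 0\<close>: on either side of \<open>n\<close> one of the two shifted copies has the constant
  value \<open>g 0 = g 1\<close>, which the last term removes.\<close>

lemma continuous_periodic_extension:
  fixes g :: "real \<Rightarrow> 'b::real_normed_vector"
  assumes g: "continuous_on UNIV g" and g01: "g 0 = g 1"
  shows "continuous_on UNIV (\<lambda>t. g (frac t))"
proof -
  define G where "G t = g (max 0 (min 1 t))" for t
  have G: "continuous_on UNIV G"
    unfolding G_def by (intro continuous_on_compose2[OF g] continuous_intros) auto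
  have "isCont (\<lambda>t. g (frac t)) t0" for t0
  proof -
    define n where "n = \<lfloor>t0\<rfloor>"
    have cont: "isCont (\<lambda>t. G (t - of_int n) + G (t - of_int n + 1) - g 0) t0"
      by (rule continuous_on_interior[of UNIV], intro continuous_intros continuous_on_compose2[OF G]) auto
    have eq: "G (t - of_int n) + G (t - of_int n + 1) - g 0 = g (frac t)"
      if t: "t \<in> {of_int n - 1<..<of_int n + 1}" for t
    proof (cases "t < of_int n")
      case True
      then have "\<lfloor>t\<rfloor> = n - 1" using t by (simp add: floor_eq_iff)
      then have "frac t = t - of_int n + 1" by (simp add: frac_def)
      then show ?thesis using True t by (simp add: G_def)
    next
      case False
      then have "\<lfloor>t\<rfloor> = n" using t by (simp add: floor_eq_iff)
      then show ?thesis using False t g01 by (simp add: frac_def G_def)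
    qed
    have t0: "t0 \<in> {of_int n - 1<..<of_int n + 1}"
      unfolding n_def by (simp; linarith)
    from cont have lim: "((\<lambda>t. G (t - of_int n) + G (t - of_int n + 1) - g 0) \<longlongrightarrow> g (frac t0)) (at t0)"
      using eq[OF t0] by (simp add: isCont_def)
    show ?thesis
      unfolding isCont_def
      by (rule Lim_transform_within_open[OF lim open_greaterThanLessThan t0]) (rule eq)
  qed
  then show ?thesis
    by (simp add: continuous_at_imp_continuous_on)
qed

text \<open>This identifies \<open>Vh J \<rho>\<close> with arbitrary vectors of \<open>J\<close> nodal values: the data are closed up
  periodically by repeating the first value at the last node, interpolated, and extended.\<close>

lemma Vh_interpolation:
  assumes m: "mesh J \<rho>"
  shows "\<exists>u\<in>Vh J \<rho>. \<forall>k<J. u (\<rho> k) = b k"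
proof -
  \<comment> \<open>The last node carries the value of the first one.\<close>
  define b' where "b' k = (if k < J then b k else b 0)" for k
  obtain g where g: "continuous_on UNIV g" "\<And>k. k \<le> J \<Longrightarrow> g (\<rho> k) = b' k"
    and aff: "\<And>j. j \<in> {1..J} \<Longrightarrow> \<exists>p q. \<forall>t\<in>mesh_int \<rho> j. g t = p + q * t"
    using piecewise_affine_interpolation[OF m order_refl, of b'] by auto
  have r: "\<rho> 0 = 0" "\<rho> J = 1" using m by (auto simp: mesh_def)
  have g01: "g 0 = g 1"
    using g(2)[of 0] g(2)[of J] r by (auto simp: b'_def split: if_splits)
  define u where "u t = g (frac t)" for t
  have u: "u t = g t" if "t \<in> {0..1}" for t
    using that g01 by (cases "t = 1") (auto simp: u_def)
  have sub: "mesh_int \<rho> j \<subseteq> {0..1}" if "j \<in> {1..J}" for j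
    using that mesh_le[OF m, of 0 "j - 1"] mesh_le[OF m, of j J] r by (auto simp: mesh_int_def)
  have "\<exists>p q. \<forall>t\<in>mesh_int \<rho> j. u t = p + q * t" if j: "j \<in> {1..J}" for j
    using aff[OF j] u sub[OF j] by (metis subsetD)
  moreover have "continuous_on UNIV u"
    unfolding u_def by (rule continuous_periodic_extension[OF g(1) g01])
  moreover have "u (t + 1) = u t" for t
    by (simp add: u_def frac_1_eq)
  ultimately have "u \<in> Vh J \<rho>"
    by (auto simp: Vh_def)
  moreover have "u (\<rho> k) = b k" if "k < J" for k
    using that g(2)[of k] u[of "\<rho> k"] mesh_le[OF m, of 0 k] mesh_le[OF m, of k J] r
    by (simp add: b'_def)
  ultimately show ?thesis by blast
qed

section \<open>Nodal form of the inner products\<close>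

text \<open>On continuous functions, with a weight equal to \<open>W j\<close> inside the \<open>j\<close>-th interval, this is the
  mass lumped inner product (\<open>lumped_nodal\<close>). It refers to point values only and is
  therefore bilinear on all functions.\<close>

definition nodal_mass ::
  "nat \<Rightarrow> (nat \<Rightarrow> real) \<Rightarrow> (nat \<Rightarrow> real) \<Rightarrow> (real \<Rightarrow> 'b::real_inner) \<Rightarrow> (real \<Rightarrow> 'b) \<Rightarrow> real" where
  "nodal_mass J \<rho> W u v = 1 / 2 * (\<Sum>j = 1..J. mesh_len J \<rho> j *
     (W j * (u (\<rho> j) \<bullet> v (\<rho> j) + u (\<rho> (j - 1)) \<bullet> v (\<rho> (j - 1)))))"

definition slope :: "nat \<Rightarrow> (nat \<Rightarrow> real) \<Rightarrow> (real \<Rightarrow> 'b::real_vector) \<Rightarrow> nat \<Rightarrow> 'b" where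
  "slope J \<rho> u j = (u (\<rho> j) - u (\<rho> (j - 1))) /\<^sub>R mesh_len J \<rho> j"

text \<open>For finite element functions this is the \<open>L\<^sup>2\<close> inner product of the derivatives. It too is
  bilinear on all functions.\<close>

definition nodal_stiffness ::
  "nat \<Rightarrow> (nat \<Rightarrow> real) \<Rightarrow> (real \<Rightarrow> 'b::real_inner) \<Rightarrow> (real \<Rightarrow> 'b) \<Rightarrow> real" where
  "nodal_stiffness J \<rho> u v = (\<Sum>j = 1..J. mesh_len J \<rho> j * (slope J \<rho> u j \<bullet> slope J \<rho> v j))"

lemma vector_derivative_Vh_vec:
  assumes m: "mesh J \<rho>" and u: "u \<in> Vh_vec J \<rho>" and j: "j \<in> {1..J}"
    and t: "t \<in> {\<rho> (j - 1)<..<\<rho> j}"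
  shows "d_rho u t = slope J \<rho> u j"
proof (rule vector_derivative_at)
  let ?f = "\<lambda>t. u (\<rho> (j - 1)) + (t - \<rho> (j - 1)) *\<^sub>R slope J \<rho> u j"
  have "(?f has_vector_derivative slope J \<rho> u j) (at t)"
    by (auto intro!: derivative_eq_intros)
  then show "(u has_vector_derivative slope J \<rho> u j) (at t)"
  proof (rule has_vector_derivative_transform_within_open[OF _ _ t])
    fix s assume "s \<in> {\<rho> (j - 1)<..<\<rho> j}"
    then have "s \<in> mesh_int \<rho> j" by (auto simp: mesh_int_def)
    from Vh_vec_affine[OF m u j this] show "?f s = u s"
      by (simp add: slope_def divide_inverse)
  qed auto
qed

lemma has_integral_piecewise_constant:
  fixes f :: "real \<Rightarrow> real"
  assumes m: "mesh J \<rho>"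
    and f: "\<And>j t. j \<in> {1..J} \<Longrightarrow> t \<in> {\<rho> (j - 1)<..<\<rho> j} \<Longrightarrow> f t = C j"
  shows "(f has_integral (\<Sum>j = 1..J. mesh_len J \<rho> j * C j)) {0..1}"
proof -
  have r: "\<rho> 0 = 0" "\<rho> J = 1" using m by (auto simp: mesh_def)
  have "(f has_integral (\<Sum>j = 1..n. mesh_len J \<rho> j * C j)) {\<rho> 0..\<rho> n}" if "n \<le> J" for n
    using that
  proof (induction n)
    case 0
    then show ?case by (simp add: has_integral_refl)
  next
    case (Suc n)
    have "((\<lambda>t. C (Suc n)) has_integral measure lborel {\<rho> n..\<rho> (Suc n)} *\<^sub>R C (Suc n)) (cbox (\<rho> n) (\<rho> (Suc n)))"
      by (metis box_real(2) has_integral_const)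
    then have "(f has_integral measure lborel {\<rho> n..\<rho> (Suc n)} *\<^sub>R C (Suc n)) (cbox (\<rho> n) (\<rho> (Suc n)))"
      by (rule has_integral_spike_interior) (use f[of "Suc n"] Suc.prems in auto)
    then have "(f has_integral mesh_len J \<rho> (Suc n) * C (Suc n)) {\<rho> n..\<rho> (Suc n)}"
      using mesh_le[OF m, of n "Suc n"] Suc.prems by (simp add: mesh_len_def)
    from has_integral_combine[OF _ _ Suc.IH this]
    show ?case
      using mesh_le[OF m, of 0 n] mesh_le[OF m, of n "Suc n"] Suc.prems by simp
  qed
  from this[of J] show ?thesis by (simp add: r)
qed

lemma L2_inner_slopes:
  assumes "mesh J \<rho>"
    and "\<And>j t. j \<in> {1..J} \<Longrightarrow> t \<in> {\<rho> (j - 1)<..<\<rho> j} \<Longrightarrow> u t = slope J \<rho> x j"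
    and "\<And>j t. j \<in> {1..J} \<Longrightarrow> t \<in> {\<rho> (j - 1)<..<\<rho> j} \<Longrightarrow> v t = slope J \<rho> y j"
  shows "L2_inner u v = nodal_stiffness J \<rho> x y"
  unfolding L2_inner_def nodal_stiffness_def
  by (rule integral_unique, rule has_integral_piecewise_constant) (use assms in auto)

lemma H1_seminorm_nodal:
  assumes "mesh J \<rho>" "u \<in> Vh_vec J \<rho>"
  shows "(H1_seminorm u)\<^sup>2 = nodal_stiffness J \<rho> u u"
proof -
  have "integral {0..1} (\<lambda>t. (norm (d_rho u t))\<^sup>2) = L2_inner (d_rho u) (d_rho u)"
    by (simp add: L2_inner_def power2_norm_eq_inner)
  also have "\<dots> = nodal_stiffness J \<rho> u u"
    by (rule L2_inner_slopes) (use assms vector_derivative_Vh_vec in blast)+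
  finally have eq: "integral {0..1} (\<lambda>t. (norm (d_rho u t))\<^sup>2) = nodal_stiffness J \<rho> u u" .
  moreover have "nodal_stiffness J \<rho> u u \<ge> 0"
    unfolding nodal_stiffness_def
    by (intro sum_nonneg mult_nonneg_nonneg) (use mesh_len_pos[OF assms(1)] in \<open>auto intro: less_imp_le\<close>)
  ultimately show ?thesis
    by (simp add: H1_seminorm_def)
qed

text \<open>The one-sided limits only see the weight in the interior of the adjacent interval, where it is
  constant, so they reduce to values of the continuous factor at the node.\<close>

lemma lumped_nodal:
  fixes u v :: "real \<Rightarrow> 'b::real_inner"
  assumes m: "mesh J \<rho>" and u: "continuous_on UNIV u" and v: "continuous_on UNIV v"
    and w: "\<And>j t. j \<in> {1..J} \<Longrightarrow> t \<in> {\<rho> (j - 1)<..<\<rho> j} \<Longrightarrow> w t = W j"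
  shows "lumped J \<rho> u (\<lambda>t. w t *\<^sub>R v t) = nodal_mass J \<rho> W u v"
proof -
  have cont: "((\<lambda>t. W j * (u t \<bullet> v t)) \<longlongrightarrow> W j * (u s \<bullet> v s)) (at s within S)" for j s S
  proof -
    have "isCont u s" "isCont v s"
      using u v by (auto simp: continuous_on_eq_continuous_at)
    then have "isCont (\<lambda>t. W j * (u t \<bullet> v t)) s"
      by (intro continuous_intros)
    then show ?thesis
      unfolding isCont_def by (rule tendsto_within_subset) simp
  qed
  have "Lim (at_left (\<rho> j)) (\<lambda>t. u t \<bullet> (w t *\<^sub>R v t)) = W j * (u (\<rho> j) \<bullet> v (\<rho> j))"
    and "Lim (at_right (\<rho> (j - 1))) (\<lambda>t. u t \<bullet> (w t *\<^sub>R v t)) =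
      W j * (u (\<rho> (j - 1)) \<bullet> v (\<rho> (j - 1)))" if j: "j \<in> {1..J}" for j
  proof -
    have less: "\<rho> (j - 1) < \<rho> j"
      using mesh_len_pos[OF m j] mesh_len_eq[OF j] by simp
    have "\<forall>\<^sub>F t in at_left (\<rho> j). t \<in> {\<rho> (j - 1)<..<\<rho> j}"
      using eventually_at_left_real[OF less] .
    then have "\<forall>\<^sub>F t in at_left (\<rho> j). W j * (u t \<bullet> v t) = u t \<bullet> (w t *\<^sub>R v t)"
      by eventually_elim (simp add: w[OF j])
    then show "Lim (at_left (\<rho> j)) (\<lambda>t. u t \<bullet> (w t *\<^sub>R v t)) = W j * (u (\<rho> j) \<bullet> v (\<rho> j))"
      by (intro tendsto_Lim Lim_transform_eventually[OF cont]) auto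
    have "\<forall>\<^sub>F t in at_right (\<rho> (j - 1)). t \<in> {\<rho> (j - 1)<..<\<rho> j}"
      using eventually_at_right_real[OF less] .
    then have "\<forall>\<^sub>F t in at_right (\<rho> (j - 1)). W j * (u t \<bullet> v t) = u t \<bullet> (w t *\<^sub>R v t)"
      by eventually_elim (simp add: w[OF j])
    then show "Lim (at_right (\<rho> (j - 1))) (\<lambda>t. u t \<bullet> (w t *\<^sub>R v t)) =
        W j * (u (\<rho> (j - 1)) \<bullet> v (\<rho> (j - 1)))"
      by (intro tendsto_Lim Lim_transform_eventually[OF cont]) auto
  qed
  then show ?thesis
    unfolding lumped_def nodal_mass_def
    by (intro arg_cong[where f = "\<lambda>s. 1 / 2 * s"] sum.cong refl) (simp add: distrib_left)
qed

lemma continuous_on_Vh_vec: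
  assumes "u \<in> Vh_vec J \<rho>"
  shows "continuous_on UNIV u"
proof -
  have "continuous_on UNIV (\<lambda>t. \<chi> i. u t $ i)"
    using assms by (intro continuous_on_vec_lambda) (auto simp: Vh_vec_def Vh_def)
  then show ?thesis by simp
qed

lemma nodal_mass_definite:
  assumes m: "mesh J \<rho>" and W: "\<forall>j\<in>{1..J}. W j \<ge> 0" and zero: "nodal_mass J \<rho> W z z = 0"
    and i: "i \<in> {1..J}" "W i > 0"
  shows "z (\<rho> i) = 0" "z (\<rho> (i - 1)) = 0"
proof -
  note h = mesh_len_pos[OF m]
  have "\<forall>j\<in>{1..J}. mesh_len J \<rho> j *
     (W j * (z (\<rho> j) \<bullet> z (\<rho> j) + z (\<rho> (j - 1)) \<bullet> z (\<rho> (j - 1)))) = 0"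
  proof (subst sum_nonneg_eq_0_iff[symmetric])
    show "(\<Sum>j = 1..J. mesh_len J \<rho> j *
        (W j * (z (\<rho> j) \<bullet> z (\<rho> j) + z (\<rho> (j - 1)) \<bullet> z (\<rho> (j - 1))))) = 0"
      using zero by (simp add: nodal_mass_def)
  qed (use W h in \<open>auto intro!: mult_nonneg_nonneg add_nonneg_nonneg intro: less_imp_le\<close>)
  from bspec[OF this i(1)]
  have "z (\<rho> i) \<bullet> z (\<rho> i) + z (\<rho> (i - 1)) \<bullet> z (\<rho> (i - 1)) = 0"
    using i(2) h[OF i(1)] by simp
  then show "z (\<rho> i) = 0" "z (\<rho> (i - 1)) = 0"
    by (metis add_nonneg_eq_0_iff inner_eq_zero_iff inner_ge_zero)+
qed

text \<open>The uniqueness and, through the linear system, the existence of solutions rest on this. Both terms are nonnegative, hence both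
  vanish; the stiffness term makes all nodal values equal, and a single interval of positive
  weight forces their common value to be zero.\<close>

lemma nodal_definite:
  assumes m: "mesh J \<rho>" and \<alpha>: "\<alpha> > 0" and \<kappa>: "\<kappa> > 0"
    and W: "\<forall>j\<in>{1..J}. W j \<ge> 0" and i: "i \<in> {1..J}" "W i > 0"
    and zero: "\<alpha> * nodal_mass J \<rho> W z z + \<kappa> * nodal_stiffness J \<rho> z z = 0"
    and k: "k \<le> J"
  shows "z (\<rho> k) = 0"
proof -
  note h = mesh_len_pos[OF m]
  have M: "nodal_mass J \<rho> W z z \<ge> 0" and K: "nodal_stiffness J \<rho> z z \<ge> 0"
    unfolding nodal_mass_def nodal_stiffness_def
    using h W by (auto intro!: sum_nonneg mult_nonneg_nonneg add_nonneg_nonneg intro: less_imp_le)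
  have "\<alpha> * nodal_mass J \<rho> W z z \<ge> 0" "\<kappa> * nodal_stiffness J \<rho> z z \<ge> 0"
    using M K \<alpha> \<kappa> by auto
  then have "\<alpha> * nodal_mass J \<rho> W z z = 0" "\<kappa> * nodal_stiffness J \<rho> z z = 0"
    using zero by linarith+
  then have M0: "nodal_mass J \<rho> W z z = 0" and K0: "nodal_stiffness J \<rho> z z = 0"
    using \<alpha> \<kappa> by auto
  have "\<forall>j\<in>{1..J}. mesh_len J \<rho> j * (slope J \<rho> z j \<bullet> slope J \<rho> z j) = 0"
    using K0 unfolding nodal_stiffness_def
    by (subst (asm) sum_nonneg_eq_0_iff) (auto intro!: mult_nonneg_nonneg intro: less_imp_le[OF h])
  then have slopes: "slope J \<rho> z j = 0" if "j \<in> {1..J}" for j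
    using that h[OF that] by force
  have step: "z (\<rho> j) = z (\<rho> (j - 1))" if "j \<in> {1..J}" for j
  proof -
    have "mesh_len J \<rho> j \<noteq> 0" and "slope J \<rho> z j = 0"
      using h[OF that] slopes[OF that] by auto
    then show ?thesis by (simp add: slope_def)
  qed
  have const: "z (\<rho> k) = z (\<rho> 0)" if "k \<le> J" for k
    using that
  proof (induction k)
    case (Suc k)
    then show ?case using step[of "Suc k"] by simp
  qed simp
  have "z (\<rho> i) = 0"
    using nodal_mass_definite(1)[OF m W M0 i] .
  then show ?thesis
    using const[of i] const[OF k] i by simp
qed

lemma slope_add_scaled:
  "slope J \<rho> (\<lambda>t. u t + r *\<^sub>R v t) j = slope J \<rho> u j + r *\<^sub>R slope J \<rho> v j"
  by (simp add: slope_def algebra_simps)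

lemma nodal_mass_add_scaled:
  "nodal_mass J \<rho> W (\<lambda>t. u t + r *\<^sub>R v t) e = nodal_mass J \<rho> W u e + r * nodal_mass J \<rho> W v e"
  "nodal_mass J \<rho> W e (\<lambda>t. u t + r *\<^sub>R v t) = nodal_mass J \<rho> W e u + r * nodal_mass J \<rho> W e v"
  by (simp_all add: nodal_mass_def sum_distrib_left inner_add_left inner_add_right algebra_simps
      flip: sum.distrib)

lemma nodal_stiffness_add_scaled:
  "nodal_stiffness J \<rho> (\<lambda>t. u t + r *\<^sub>R v t) e = nodal_stiffness J \<rho> u e + r * nodal_stiffness J \<rho> v e"
  "nodal_stiffness J \<rho> e (\<lambda>t. u t + r *\<^sub>R v t) = nodal_stiffness J \<rho> e u + r * nodal_stiffness J \<rho> e v"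
  by (simp_all add: nodal_stiffness_def slope_add_scaled sum_distrib_left inner_add_left inner_add_right
      algebra_simps flip: sum.distrib)

lemma nodal_mass_components:
  fixes u v :: "real \<Rightarrow> real ^ 'd"
  shows "nodal_mass J \<rho> W u v = (\<Sum>i\<in>UNIV. nodal_mass J \<rho> W (\<lambda>t. u t $ i) (\<lambda>t. v t $ i))"
  unfolding nodal_mass_def sum_distrib_left[symmetric]
  by (subst sum.swap) (simp add: inner_vec_def sum.distrib sum_distrib_left distrib_left)

lemma nodal_stiffness_components:
  fixes u v :: "real \<Rightarrow> real ^ 'd"
  shows "nodal_stiffness J \<rho> u v = (\<Sum>i\<in>UNIV. nodal_stiffness J \<rho> (\<lambda>t. u t $ i) (\<lambda>t. v t $ i))"
  unfolding nodal_stiffness_def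
  by (subst sum.swap) (simp add: inner_vec_def slope_def sum_distrib_left)

section \<open>Solvability and stability of the scheme\<close>

text \<open>The hat functions, one for each node, turn the variational problem into a square system, and
  every test function is the combination of hat functions with its own nodal values as
  coefficients.\<close>

lemma scalar_step_solvable:
  assumes m: "mesh J \<rho>" and \<alpha>: "\<alpha> > 0" and \<kappa>: "\<kappa> > 0"
    and W: "\<forall>j\<in>{1..J}. W j \<ge> 0" and i: "i \<in> {1..J}" "W i > 0"
  shows "\<exists>z\<in>Vh J \<rho>. \<forall>e\<in>Vh J \<rho>.
    \<alpha> * nodal_mass J \<rho> W z e + \<kappa> * nodal_stiffness J \<rho> z e + nodal_stiffness J \<rho> y e = 0"
proof -
  have "\<exists>\<phi>. \<phi> \<in> Vh J \<rho> \<and> (\<forall>l<J. \<phi> (\<rho> l) = (if l = k then 1 else 0))" for k :: nat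
    using Vh_interpolation[OF m, of "\<lambda>l. if l = k then 1 else 0"] by blast
  then obtain \<phi> where \<phi>: "\<And>k. \<phi> k \<in> Vh J \<rho>"
    and hat: "\<And>k l. l < J \<Longrightarrow> \<phi> k (\<rho> l) = (if l = k then 1 else 0)"
    by metis
  let ?S = "\<lambda>c t. \<Sum>k<J. c k * \<phi> k t"
  have S: "?S c \<in> Vh J \<rho>" for c
    by (rule sum_in_Vh[OF \<phi>])
  have S_node: "?S c (\<rho> l) = c l" if "l < J" for c l
    using that by (simp add: hat if_distrib[of "\<lambda>x. _ * x"] cong: if_cong)
  define a where "a u e = \<alpha> * nodal_mass J \<rho> W u e + \<kappa> * nodal_stiffness J \<rho> u e"
    for u e :: "real \<Rightarrow> real"
  have "\<exists>c. \<forall>d. a (?S c) (?S d) = - nodal_stiffness J \<rho> y (?S d)"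
  proof (rule galerkin_solvable)
    fix c assume "a (?S c) (?S c) = 0"
    then have "?S c (\<rho> k) = 0" if "k < J" for k
      unfolding a_def by (rule nodal_definite[OF m \<alpha> \<kappa> W i]) (use that in auto)
    then show "\<forall>k<J. c k = 0"
      by (simp only: S_node) blast
  qed (use nodal_mass_add_scaled[of J \<rho> W, where ?'a = real]
      nodal_stiffness_add_scaled[of J \<rho>, where ?'a = real]
      in \<open>simp_all add: a_def algebra_simps\<close>)
  then obtain c where c: "\<And>d. a (?S c) (?S d) = - nodal_stiffness J \<rho> y (?S d)"
    by blast
  have "a (?S c) e + nodal_stiffness J \<rho> y e = 0" if e: "e \<in> Vh J \<rho>" for e
  proof -
    have "?S (\<lambda>k. e (\<rho> k)) = e"
      by (rule Vh_eqI[OF m S e]) (simp only: S_node)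
    then show ?thesis
      using c[of "\<lambda>k. e (\<rho> k)"] by simp
  qed
  then show ?thesis
    unfolding a_def using S[of c] by blast
qed

text \<open>Existence is obtained coordinate by coordinate, which is possible because the weight is
  scalar. Uniqueness follows by testing the difference of two solutions with itself.\<close>

lemma step_uniquely_solvable:
  fixes y :: "real \<Rightarrow> real ^ 'd"
  assumes m: "mesh J \<rho>" and y: "y \<in> Vh_vec J \<rho>" and \<alpha>: "\<alpha> > 0" and \<kappa>: "\<kappa> > 0"
    and W: "\<forall>j\<in>{1..J}. W j \<ge> 0" and i: "i \<in> {1..J}" "W i > 0"
  shows "\<exists>!x. x \<in> Vh_vec J \<rho> \<and> (\<forall>\<eta>\<in>Vh_vec J \<rho>.
    \<alpha> * nodal_mass J \<rho> W (\<lambda>t. x t - y t) \<eta> + \<kappa> * nodal_stiffness J \<rho> (\<lambda>t. x t - y t) \<eta>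
      + nodal_stiffness J \<rho> y \<eta> = 0)" (is "\<exists>!x. ?sol x")
proof -
  have "\<exists>z. z \<in> Vh J \<rho> \<and> (\<forall>e\<in>Vh J \<rho>. \<alpha> * nodal_mass J \<rho> W z e + \<kappa> * nodal_stiffness J \<rho> z e
      + nodal_stiffness J \<rho> (\<lambda>t. y t $ k) e = 0)" for k
    using scalar_step_solvable[OF m \<alpha> \<kappa> W i] by blast
  then obtain z where z: "\<And>k. z k \<in> Vh J \<rho>"
    and z_eq: "\<And>k e. e \<in> Vh J \<rho> \<Longrightarrow> \<alpha> * nodal_mass J \<rho> W (z k) e
      + \<kappa> * nodal_stiffness J \<rho> (z k) e + nodal_stiffness J \<rho> (\<lambda>t. y t $ k) e = 0"
    by metis
  define x where "x t = y t + (\<chi> k. z k t)" for t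
  have "?sol x"
  proof (intro conjI ballI)
    have "(\<lambda>t. \<chi> k. z k t) \<in> Vh_vec J \<rho>"
      using z by (simp add: Vh_vec_def)
    then show "x \<in> Vh_vec J \<rho>"
      unfolding x_def by (rule Vh_vec_add[OF y])
    fix \<eta> :: "real \<Rightarrow> real ^ 'd" assume \<eta>: "\<eta> \<in> Vh_vec J \<rho>"
    have "\<alpha> * nodal_mass J \<rho> W (\<lambda>t. x t - y t) \<eta> + \<kappa> * nodal_stiffness J \<rho> (\<lambda>t. x t - y t) \<eta>
        + nodal_stiffness J \<rho> y \<eta> =
      (\<Sum>k\<in>UNIV. \<alpha> * nodal_mass J \<rho> W (z k) (\<lambda>t. \<eta> t $ k)
        + \<kappa> * nodal_stiffness J \<rho> (z k) (\<lambda>t. \<eta> t $ k)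
        + nodal_stiffness J \<rho> (\<lambda>t. y t $ k) (\<lambda>t. \<eta> t $ k))"
      by (simp add: nodal_mass_components nodal_stiffness_components[where v = \<eta>] x_def sum.distrib
          sum_distrib_left)
    also have "\<dots> = 0"
      by (rule sum.neutral) (use \<eta> z_eq in \<open>auto simp: Vh_vec_def\<close>)
    finally show "\<alpha> * nodal_mass J \<rho> W (\<lambda>t. x t - y t) \<eta>
      + \<kappa> * nodal_stiffness J \<rho> (\<lambda>t. x t - y t) \<eta> + nodal_stiffness J \<rho> y \<eta> = 0" .
  qed
  moreover have "x1 = x2" if x1: "?sol x1" and x2: "?sol x2" for x1 x2
  proof -
    define d where "d t = x1 t - x2 t" for t
    have d: "d \<in> Vh_vec J \<rho>"
      unfolding d_def using x1 x2 by (intro Vh_vec_diff) auto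
    have dd: "(\<lambda>t. x1 t - y t) = (\<lambda>t. (x2 t - y t) + 1 *\<^sub>R d t)"
      by (simp add: d_def)
    have "\<alpha> * nodal_mass J \<rho> W d d + \<kappa> * nodal_stiffness J \<rho> d d = 0"
      using bspec[OF conjunct2[OF x1] d] bspec[OF conjunct2[OF x2] d]
      unfolding dd nodal_mass_add_scaled nodal_stiffness_add_scaled by (simp add: algebra_simps)
    then have "d (\<rho> k) = 0" if "k \<le> J" for k
      using nodal_definite[OF m \<alpha> \<kappa> W i] that by blast
    then show ?thesis
      using x1 x2 by (intro Vh_vec_eqI[OF m]) (auto simp: d_def)
  qed
  ultimately show ?thesis by blast
qed

lemma nodal_mass_scaleR_left:
  "nodal_mass J \<rho> W (\<lambda>t. r *\<^sub>R u t) e = r * nodal_mass J \<rho> W u e"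
  using nodal_mass_add_scaled(1)[of J \<rho> W u "r - 1" u e] by (simp add: algebra_simps)

lemma lumped_residual_nodal:
  assumes m: "mesh J \<rho>" and "x \<in> Vh_vec J \<rho>" "y \<in> Vh_vec J \<rho>" "\<eta> \<in> Vh_vec J \<rho>" "v \<in> Vh_vec J \<rho>"
  shows "lumped J \<rho> (\<lambda>t. (x t - y t) /\<^sub>R r) (\<lambda>t. (norm (d_rho v t))\<^sup>2 *\<^sub>R \<eta> t) =
    1 / r * nodal_mass J \<rho> (\<lambda>j. (norm (slope J \<rho> v j))\<^sup>2) (\<lambda>t. x t - y t) \<eta>"
proof -
  have "continuous_on UNIV (\<lambda>t. (x t - y t) /\<^sub>R r)" "continuous_on UNIV \<eta>"
    using assms(2-4)[THEN continuous_on_Vh_vec] by (auto intro!: continuous_intros)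
  then have "lumped J \<rho> (\<lambda>t. (x t - y t) /\<^sub>R r) (\<lambda>t. (norm (d_rho v t))\<^sup>2 *\<^sub>R \<eta> t) =
      nodal_mass J \<rho> (\<lambda>j. (norm (slope J \<rho> v j))\<^sup>2) (\<lambda>t. (x t - y t) /\<^sub>R r) \<eta>"
    by (rule lumped_nodal[OF m]) (simp add: vector_derivative_Vh_vec[OF m assms(5)] del: One_nat_def)
  then show ?thesis
    by (simp add: nodal_mass_scaleR_left inverse_eq_divide)
qed

text \<open>The factor \<open>1 * _\<close> is the parameter \<open>\<kappa>\<close> of \<open>step_uniquely_solvable\<close>.\<close>

lemma predictor_sol_nodal:
  assumes m: "mesh J \<rho>" and xm: "xm \<in> Vh_vec J \<rho>"
  shows "predictor_sol J \<rho> \<tau> xm x \<longleftrightarrow> x \<in> Vh_vec J \<rho> \<and> (\<forall>\<eta>\<in>Vh_vec J \<rho>.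
    2 / \<tau> * nodal_mass J \<rho> (\<lambda>j. (norm (slope J \<rho> xm j))\<^sup>2) (\<lambda>t. x t - xm t) \<eta>
      + 1 * nodal_stiffness J \<rho> (\<lambda>t. x t - xm t) \<eta> + nodal_stiffness J \<rho> xm \<eta> = 0)"
proof -
  have "lumped J \<rho> (\<lambda>t. (x t - xm t) /\<^sub>R (1 / 2 * \<tau>)) (\<lambda>t. (norm (d_rho xm t))\<^sup>2 *\<^sub>R \<eta> t)
        + L2_inner (d_rho x) (d_rho \<eta>) =
      2 / \<tau> * nodal_mass J \<rho> (\<lambda>j. (norm (slope J \<rho> xm j))\<^sup>2) (\<lambda>t. x t - xm t) \<eta>
      + 1 * nodal_stiffness J \<rho> (\<lambda>t. x t - xm t) \<eta> + nodal_stiffness J \<rho> xm \<eta>"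
    if x: "x \<in> Vh_vec J \<rho>" and \<eta>: "\<eta> \<in> Vh_vec J \<rho>" for \<eta>
  proof -
    have "L2_inner (d_rho x) (d_rho \<eta>) = nodal_stiffness J \<rho> x \<eta>"
      by (rule L2_inner_slopes[OF m]) (use m x \<eta> vector_derivative_Vh_vec in blast)+
    also have "\<dots> = nodal_stiffness J \<rho> (\<lambda>t. x t - xm t) \<eta> + nodal_stiffness J \<rho> xm \<eta>"
      using nodal_stiffness_add_scaled(1)[of J \<rho> "\<lambda>t. x t - xm t" 1 xm \<eta>] by simp
    finally show ?thesis
      unfolding lumped_residual_nodal[OF m x xm \<eta> xm] by simp
  qed
  then show ?thesis
    unfolding predictor_sol_def by (intro conj_cong refl ball_cong) simp_all
qed

text \<open>The average of derivatives is rewritten by \<open>x + x\<^sup>m = (x - x\<^sup>m) + 2 x\<^sup>m\<close>, so that the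
  increment is the unknown and the last term is the same as for the predictor.\<close>

lemma corrector_sol_nodal:
  assumes m: "mesh J \<rho>" and xm: "xm \<in> Vh_vec J \<rho>" and xh: "xh \<in> Vh_vec J \<rho>"
  shows "corrector_sol J \<rho> \<tau> xm xh x \<longleftrightarrow> x \<in> Vh_vec J \<rho> \<and> (\<forall>\<eta>\<in>Vh_vec J \<rho>.
    1 / \<tau> * nodal_mass J \<rho> (\<lambda>j. (norm (slope J \<rho> xh j))\<^sup>2) (\<lambda>t. x t - xm t) \<eta>
      + 1 / 2 * nodal_stiffness J \<rho> (\<lambda>t. x t - xm t) \<eta> + nodal_stiffness J \<rho> xm \<eta> = 0)"
proof -
  have "lumped J \<rho> (\<lambda>t. (x t - xm t) /\<^sub>R \<tau>) (\<lambda>t. (norm (d_rho xh t))\<^sup>2 *\<^sub>R \<eta> t)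
        + 1 / 2 * L2_inner (\<lambda>t. d_rho x t + d_rho xm t) (d_rho \<eta>) =
      1 / \<tau> * nodal_mass J \<rho> (\<lambda>j. (norm (slope J \<rho> xh j))\<^sup>2) (\<lambda>t. x t - xm t) \<eta>
      + 1 / 2 * nodal_stiffness J \<rho> (\<lambda>t. x t - xm t) \<eta> + nodal_stiffness J \<rho> xm \<eta>"
    if x: "x \<in> Vh_vec J \<rho>" and \<eta>: "\<eta> \<in> Vh_vec J \<rho>" for \<eta>
  proof -
    have "L2_inner (\<lambda>t. d_rho x t + d_rho xm t) (d_rho \<eta>) =
        nodal_stiffness J \<rho> (\<lambda>t. (x t - xm t) + 2 *\<^sub>R xm t) \<eta>"
    proof (rule L2_inner_slopes[OF m])
      fix j t assume jt: "j \<in> {1..J}" "t \<in> {\<rho> (j - 1)<..<\<rho> j}"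
      show "d_rho \<eta> t = slope J \<rho> \<eta> j"
        by (rule vector_derivative_Vh_vec[OF m \<eta> jt])
      show "d_rho x t + d_rho xm t = slope J \<rho> (\<lambda>t. (x t - xm t) + 2 *\<^sub>R xm t) j"
        unfolding vector_derivative_Vh_vec[OF m x jt] vector_derivative_Vh_vec[OF m xm jt]
        by (simp add: slope_def algebra_simps scaleR_2)
    qed
    also have "\<dots> = nodal_stiffness J \<rho> (\<lambda>t. x t - xm t) \<eta> + 2 * nodal_stiffness J \<rho> xm \<eta>"
      by (rule nodal_stiffness_add_scaled)
    finally show ?thesis
      by (simp add: lumped_residual_nodal[OF m x xm \<eta> xh])
  qed
  then show ?thesis
    unfolding corrector_sol_def by (intro conj_cong refl ball_cong) simp_all
qed

text \<open>If all slopes of the predictor vanish, the stiffness term drops out and only the mass term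
  remains. Tested with the increment itself it shows that predictor and \<open>x\<^sup>m\<close> agree at both ends of any
  interval where \<open>x\<^sup>m\<close> has a nonzero slope, which is impossible as the predictor has
  slope zero there.\<close>

lemma predictor_not_constant:
  assumes m: "mesh J \<rho>" and xm: "xm \<in> Vh_vec J \<rho>" and \<tau>: "\<tau> > 0"
    and xh: "predictor_sol J \<rho> \<tau> xm xh"
    and i: "i \<in> {1..J}" "slope J \<rho> xm i \<noteq> 0"
  shows "\<exists>j\<in>{1..J}. slope J \<rho> xh j \<noteq> 0"
proof (rule ccontr)
  assume "\<not> ?thesis"
  then have flat: "slope J \<rho> xh j = 0" if "j \<in> {1..J}" for j
    using that by blast
  let ?W = "\<lambda>j. (norm (slope J \<rho> xm j))\<^sup>2"
  let ?z = "\<lambda>t. xh t - xm t"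
  have "xh \<in> Vh_vec J \<rho>"
    using xh by (simp add: predictor_sol_def)
  then have z: "?z \<in> Vh_vec J \<rho>"
    using xm by (rule Vh_vec_diff)
  \<comment> \<open>The left-hand side is the stiffness form of the predictor against \<open>?z\<close>.\<close>
  have K: "nodal_stiffness J \<rho> ?z ?z + nodal_stiffness J \<rho> xm ?z = 0"
    using nodal_stiffness_add_scaled(1)[of J \<rho> ?z 1 xm ?z] by (simp add: nodal_stiffness_def flat)
  have "2 / \<tau> * nodal_mass J \<rho> ?W ?z ?z
      + 1 * nodal_stiffness J \<rho> ?z ?z + nodal_stiffness J \<rho> xm ?z = 0"
    using xh z unfolding predictor_sol_nodal[OF m xm] by blast
  with K have "2 / \<tau> * nodal_mass J \<rho> ?W ?z ?z = 0"
    by linarith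
  then have M: "nodal_mass J \<rho> ?W ?z ?z = 0"
    using \<tau> by simp
  have slopes: "slope J \<rho> ?z j = - slope J \<rho> xm j" if "j \<in> {1..J}" for j
    using flat[OF that] mesh_len_pos[OF m that] by (simp add: slope_def algebra_simps)
  have "?z (\<rho> i) = 0" "?z (\<rho> (i - 1)) = 0"
    by (rule nodal_mass_definite[OF m _ M i(1)]; use i(2) in simp)+
  then have "slope J \<rho> ?z i = 0"
    by (simp add: slope_def)
  then show False
    using slopes[OF i(1)] i(2) by simp
qed

text \<open>Test with the increment \<open>z = x - x\<^sup>m\<close> and expand
  \<open>|x|\<^sub>1\<^sup>2 = |x\<^sup>m|\<^sub>1\<^sup>2 + 2 (x\<^sup>m\<^sub>\<rho>, z\<^sub>\<rho>) + |z|\<^sub>1\<^sup>2\<close>.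
  The corrector equation turns the last two terms into \<open>- 2 / \<tau>\<close> times the weighted mass of \<open>z\<close>.\<close>

lemma corrector_energy:
  assumes m: "mesh J \<rho>" and xm: "xm \<in> Vh_vec J \<rho>" and xh: "xh \<in> Vh_vec J \<rho>"
    and sol: "corrector_sol J \<rho> \<tau> xm xh x"
  shows "1 / 2 * (H1_seminorm x)\<^sup>2
        + 1 / \<tau> * lumped J \<rho> (\<lambda>t. (norm (x t - xm t))\<^sup>2) (\<lambda>t. (norm (d_rho xh t))\<^sup>2)
        = 1 / 2 * (H1_seminorm xm)\<^sup>2"
proof -
  let ?W = "\<lambda>j. (norm (slope J \<rho> xh j))\<^sup>2"
  define z where "z t = x t - xm t" for t
  have x: "x \<in> Vh_vec J \<rho>"
    using sol by (simp add: corrector_sol_def)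
  have z: "z \<in> Vh_vec J \<rho>"
    unfolding z_def by (rule Vh_vec_diff[OF x xm])
  have "lumped J \<rho> (\<lambda>t. (norm (x t - xm t))\<^sup>2) (\<lambda>t. (norm (d_rho xh t))\<^sup>2) =
      lumped J \<rho> z (\<lambda>t. (norm (d_rho xh t))\<^sup>2 *\<^sub>R z t)"
    by (simp add: lumped_def z_def power2_norm_eq_inner mult.commute)
  also have "\<dots> = nodal_mass J \<rho> ?W z z"
    by (rule lumped_nodal[OF m continuous_on_Vh_vec[OF z] continuous_on_Vh_vec[OF z]])
      (simp add: vector_derivative_Vh_vec[OF m xh] del: One_nat_def)
  finally have lump: "lumped J \<rho> (\<lambda>t. (norm (x t - xm t))\<^sup>2) (\<lambda>t. (norm (d_rho xh t))\<^sup>2) =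
      nodal_mass J \<rho> ?W z z" .
  have "1 / \<tau> * nodal_mass J \<rho> ?W z z + 1 / 2 * nodal_stiffness J \<rho> z z + nodal_stiffness J \<rho> xm z = 0"
    using sol z unfolding corrector_sol_nodal[OF m xm xh] z_def by blast
  moreover have "nodal_stiffness J \<rho> x x =
      nodal_stiffness J \<rho> xm xm + 2 * nodal_stiffness J \<rho> xm z + nodal_stiffness J \<rho> z z"
  proof -
    have "x = (\<lambda>t. xm t + 1 *\<^sub>R z t)"
      by (simp add: z_def)
    moreover have "nodal_stiffness J \<rho> z xm = nodal_stiffness J \<rho> xm z"
      by (simp add: nodal_stiffness_def inner_commute)
    ultimately show ?thesis
      by (simp only: nodal_stiffness_add_scaled) simp
  qed
  ultimately show ?thesis
    unfolding lump H1_seminorm_nodal[OF m x] H1_seminorm_nodal[OF m xm] by linarith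
qed

theorem theorem3p1:
  fixes J :: nat and \<rho> :: "nat \<Rightarrow> real" and c \<tau> :: real and xm :: "real \<Rightarrow> real ^ 'd"
  assumes "CARD('d) \<ge> 2"
    and "J \<ge> 3" and "mesh J \<rho>" and "mesh_regular c J \<rho>"
    and "\<tau> > 0"
    and "xm \<in> Vh_vec J \<rho>"
    and "\<forall>j\<in>{1..J}. \<forall>t\<in>interior (mesh_int \<rho> j). norm (d_rho xm t) > 0"
  shows "(\<exists>!xh. predictor_sol J \<rho> \<tau> xm xh) \<and>
    (\<forall>xh. predictor_sol J \<rho> \<tau> xm xh \<longrightarrow>
      (\<exists>!x. corrector_sol J \<rho> \<tau> xm xh x) \<and>
      (\<forall>x. corrector_sol J \<rho> \<tau> xm xh x \<longrightarrow>
        1 / 2 * (H1_seminorm x)\<^sup>2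
        + 1 / \<tau> * lumped J \<rho> (\<lambda>t. (norm (x t - xm t))\<^sup>2) (\<lambda>t. (norm (d_rho xh t))\<^sup>2)
        = 1 / 2 * (H1_seminorm xm)\<^sup>2))"
proof -
  note m = \<open>mesh J \<rho>\<close> and xm = \<open>xm \<in> Vh_vec J \<rho>\<close> and \<tau> = \<open>\<tau> > 0\<close>
  have one: "1 \<in> {1..J}"
    using \<open>J \<ge> 3\<close> by simp
  define t where "t = (\<rho> 0 + \<rho> 1) / 2"
  have t: "t \<in> {\<rho> (1 - 1)<..<\<rho> 1}"
    using mesh_less[OF m, of 0 1] one by (simp add: t_def)
  then have "t \<in> interior (mesh_int \<rho> 1)"
    by (simp add: mesh_int_def)
  then have "norm (d_rho xm t) > 0"
    using assms(7) one by blast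
  then have slope: "slope J \<rho> xm 1 \<noteq> 0"
    using vector_derivative_Vh_vec[OF m xm one t] by simp
  have predictor: "\<exists>!xh. predictor_sol J \<rho> \<tau> xm xh"
    unfolding predictor_sol_nodal[OF m xm]
    by (rule step_uniquely_solvable[OF m xm _ _ _ one]) (use \<tau> slope in simp_all)
  have corrector: "\<exists>!x. corrector_sol J \<rho> \<tau> xm xh x" if pred: "predictor_sol J \<rho> \<tau> xm xh" for xh
  proof -
    have xh: "xh \<in> Vh_vec J \<rho>"
      using pred by (simp add: predictor_sol_def)
    obtain j where j: "j \<in> {1..J}" "slope J \<rho> xh j \<noteq> 0"
      using predictor_not_constant[OF m xm \<tau> pred one slope] by blast
    show ?thesis
      unfolding corrector_sol_nodal[OF m xm xh]
      by (rule step_uniquely_solvable[OF m xm _ _ _ j(1)]) (simp_all add: \<tau> j(2))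
  qed
  show ?thesis
  proof (intro conjI allI impI)
    fix xh x assume "predictor_sol J \<rho> \<tau> xm xh" and sol: "corrector_sol J \<rho> \<tau> xm xh x"
    then have "xh \<in> Vh_vec J \<rho>"
      by (simp add: predictor_sol_def)
    then show "1 / 2 * (H1_seminorm x)\<^sup>2
        + 1 / \<tau> * lumped J \<rho> (\<lambda>t. (norm (x t - xm t))\<^sup>2) (\<lambda>t. (norm (d_rho xh t))\<^sup>2)
        = 1 / 2 * (H1_seminorm xm)\<^sup>2"
      using sol by (rule corrector_energy[OF m xm])
  qed (fact predictor, fact corrector)
qed

end
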